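(* For every real constant $c>0$ and every positive integer $N_0$, there exist an integer $N\ge N_0$ and a bipartite graph $G$ on $N$ vertices such that $G$ contains no cycle of length $10$ (i.e. $G$ is $C_{10}$-free), and every subgraph of $G$ with at least $c\,|E(G)|$ edges contains a cycle of length $8$ (a copy of $C_8$).
   Context: $C_m$ denotes the cycle of length $m$. A graph is $F$-free if it contains no subgraph isomorphic to $F$. *)

theory Defs
  imports Complex_Main
begin

definition simple_graph :: "'a set \<Rightarrow> 'a set set \<Rightarrow> bool" where
  "simple_graph V E \<longleftrightarrow> finite V \<and>
     (\<forall>e\<in>E. \<exists>u v. e = {u, v} \<and> u \<noteq> v \<and> u \<in> V \<and> v \<in> V)"

definition bipartite :: "'a set \<Rightarrow> 'a set set \<Rightarrow> bool" where
  "bipartite V E \<longleftrightarrow> (\<exists>A. A \<subseteq> V \<and>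
     (\<forall>u v. {u, v} \<in> E \<longrightarrow> (u \<in> A \<longleftrightarrow> v \<notin> A)))"

definition has_cycle :: "nat \<Rightarrow> 'a set set \<Rightarrow> bool" where
  "has_cycle m E \<longleftrightarrow> 3 \<le> m \<and> (\<exists>f :: nat \<Rightarrow> 'a. inj_on f {..<m} \<and>
     (\<forall>i<m. {f i, f ((i + 1) mod m)} \<in> E))"

end

theory Submission
  imports Defs "HOL-Library.FuncSet"
begin

text \<open>
  The graph is the incidence graph of the points and the axis-parallel lines of the grid
  \<open>[n]\<^sup>r\<close>, with \<open>r \<ge> 2 / c\<close> and \<open>n\<close> large. A 10-cycle is a closed walk through 5 points in which
  consecutive steps have different directions; a direction that is used must be used
  at least twice for the walk to close up, and it can be used at most twice
  because its uses are not adjacent, which is impossible as 5 is odd. For the density,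
  a set of at least \<open>c r n\<^sup>r \<ge> 2 n\<^sup>r\<close> incidences contains, for some pair of
  directions \<open>i \<noteq> j\<close>, a positive fraction of points whose lines in both directions are chosen.
  The Kovari--Sos--Turan counting argument finds among them the corners of a rectangle with sides in
  the directions \<open>i\<close> and \<open>j\<close>, and the perimeter of a rectangle is an 8-cycle.
\<close>

section \<open>Transport of graphs along injections\<close>

lemma has_cycle_image:
  assumes "has_cycle m E" "inj_on h W" "\<Union>E \<subseteq> W"
  shows "has_cycle m ((`) h ` E)"
proof -
  obtain f where f: "3 \<le> m" "inj_on f {..<m}" "\<And>i. i < m \<Longrightarrow> {f i, f ((i + 1) mod m)} \<in> E"
    using assms(1) by (auto simp: has_cycle_def)
  have "f ` {..<m} \<subseteq> W"
    using f(3) assms(3) by blast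
  then have "inj_on (h \<circ> f) {..<m}"
    using f(2) assms(2) by (meson comp_inj_on inj_on_subset)
  moreover have "{(h \<circ> f) i, (h \<circ> f) ((i + 1) mod m)} \<in> (`) h ` E" if "i < m" for i
    using imageI[OF f(3)[OF that], of "(`) h"] by simp
  ultimately show ?thesis
    using f(1) unfolding has_cycle_def by blast
qed

lemma image_image_inv_into:
  assumes "inj_on h V" "\<Union>E \<subseteq> V"
  shows "(`) (inv_into V h) ` (`) h ` E = E"
proof -
  have "inv_into V h ` h ` e = e" if "e \<in> E" for e
    using assms that by (metis Sup_le_iff inv_into_image_cancel)
  then show ?thesis
    by (simp add: image_image)
qed

lemma simple_graph_edgeE:
  assumes "simple_graph V E" "e \<in> E"
  obtains u v where "e = {u, v}" "u \<noteq> v" "u \<in> V" "v \<in> V"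
  using assms unfolding simple_graph_def by metis

lemma simple_graph_image:
  assumes "simple_graph V E" "inj_on h V"
  shows "simple_graph (h ` V) ((`) h ` E)"
  unfolding simple_graph_def
proof (intro conjI ballI)
  show "finite (h ` V)"
    using assms(1) by (simp add: simple_graph_def)
next
  fix e assume "e \<in> (`) h ` E"
  then obtain e' where e': "e' \<in> E" "e = h ` e'"
    by auto
  obtain u v where uv: "e' = {u, v}" "u \<noteq> v" "u \<in> V" "v \<in> V"
    using simple_graph_edgeE[OF assms(1) e'(1)] .
  show "\<exists>u v. e = {u, v} \<and> u \<noteq> v \<and> u \<in> h ` V \<and> v \<in> h ` V"
    using e'(2) uv assms(2)
    by (intro exI[of _ "h u"] exI[of _ "h v"]) (simp add: inj_on_eq_iff)
qed

lemma bipartite_image: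
  assumes "simple_graph V E" "bipartite V E" "inj_on h V"
  shows "bipartite (h ` V) ((`) h ` E)"
proof -
  obtain A where A: "A \<subseteq> V" "\<And>u v. {u, v} \<in> E \<Longrightarrow> u \<in> A \<longleftrightarrow> v \<notin> A"
    using assms(2) by (auto simp: bipartite_def)
  have "u \<in> h ` A \<longleftrightarrow> v \<notin> h ` A" if uv: "{u, v} \<in> (`) h ` E" for u v
  proof -
    obtain e where e: "e \<in> E" "{u, v} = h ` e"
      using uv by (rule imageE)
    obtain a b where "e = {a, b}" "a \<in> V" "b \<in> V"
      using simple_graph_edgeE[OF assms(1) e(1)] by metis
    then have ab: "{u, v} = {h a, h b}" "{a, b} \<in> E" "a \<in> V" "b \<in> V"
      using e by simp_all
    have "h a \<in> h ` A \<longleftrightarrow> a \<in> A" "h b \<in> h ` A \<longleftrightarrow> b \<in> A"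
      using ab A(1) assms(3) by (simp_all add: inj_on_image_mem_iff)
    then show ?thesis
      using ab(1) A(2)[OF ab(2)] by (auto simp: doubleton_eq_iff)
  qed
  then show ?thesis
    using A(1) unfolding bipartite_def by (intro exI[of _ "h ` A"]) blast
qed

text \<open>The vertices of the grid graph are points and lines, whereas the goal asks for an
  initial segment of the naturals. A subgraph \<open>F\<close> of the copy is pulled back to
  \<open>E\<close>, its cycle is found there by \<open>dense\<close>, and the cycle is pushed
  forward along the bijection \<open>h\<close>.\<close>

lemma transport_to_nat:
  fixes V :: "'a set"
  assumes G: "simple_graph V E" "bipartite V E" "\<not> has_cycle l E"
    and dense: "\<And>F. F \<subseteq> E \<Longrightarrow> real (card F) \<ge> c * real (card E) \<Longrightarrow> has_cycle m F"
  shows "\<exists>E' :: nat set set. simple_graph {..<card V} E' \<and> bipartite {..<card V} E' \<and>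
           \<not> has_cycle l E' \<and>
           (\<forall>F \<subseteq> E'. real (card F) \<ge> c * real (card E') \<longrightarrow> has_cycle m F)"
proof -
  have "finite V"
    using G(1) by (simp add: simple_graph_def)
  then obtain h where h: "bij_betw h V {..<card V}"
    using ex_bij_betw_finite_nat lessThan_atLeast0 by metis
  then have inj: "inj_on h V" and hV: "h ` V = {..<card V}"
    by (auto simp: bij_betw_def)
  define g where "g = inv_into V h"
  define E' where "E' = (`) h ` E"
  have inj_g: "inj_on g {..<card V}"
    unfolding g_def using hV by (metis inj_on_inv_into order_refl)
  have UE: "\<Union>E \<subseteq> V"
    using simple_graph_edgeE[OF G(1)] by (metis Sup_least empty_subsetI insert_subset)
  then have UE': "\<Union>E' \<subseteq> {..<card V}"
    unfolding E'_def hV[symmetric] by blast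
  have gE': "(`) g ` E' = E"
    unfolding g_def E'_def by (rule image_image_inv_into[OF inj UE])
  \<comment> \<open>Distinct edges stay distinct under \<open>g\<close>, so pulling back preserves
    edge counts and hence the density bound with the same \<open>c\<close>.\<close>
  have injs_g: "inj_on ((`) g) E'"
    using inj_g UE' by (meson Pow_iff Sup_le_iff inj_on_image_Pow inj_on_subset subsetI)
  have "has_cycle m F" if F: "F \<subseteq> E'" "real (card F) \<ge> c * real (card E')" for F
  proof -
    let ?F = "(`) g ` F"
    have "card ?F = card F" "card E' = card E"
      using injs_g F(1) gE' by (metis card_image inj_on_subset)+
    moreover have sub: "?F \<subseteq> E"
      using F(1) gE' by blast
    ultimately have "has_cycle m ?F"
      using dense F(2) by simp
    then have "has_cycle m ((`) h ` ?F)"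
      using sub UE by (intro has_cycle_image[OF _ inj]) (meson Sup_subset_mono order_trans)+
    moreover have "h ` g ` e = e" if "e \<in> F" for e
      using F(1) UE' that hV unfolding g_def by (intro image_inv_into_cancel) auto
    ultimately show ?thesis
      by (simp add: image_image)
  qed
  moreover have "\<not> has_cycle l E'"
    using has_cycle_image[of l E' g] inj_g UE' gE' G(3) by auto
  moreover have "simple_graph {..<card V} E'" "bipartite {..<card V} E'"
    using simple_graph_image[OF G(1) inj] bipartite_image[OF G(1,2) inj]
    unfolding hV E'_def by auto
  ultimately show ?thesis
    by blast
qed

section \<open>Double counting\<close>

text \<open>A fibre of size \<open>d\<close> contains \<open>d * d - d\<close> ordered pairs of
  distinct elements. If \<open>d \<le> k\<close> then \<open>k * d \<le> k ^ 2\<close>; otherwise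
  \<open>k \<le> d - 1\<close> and the pairs alone suffice. Summing over the fibres gives a linear
  substitute for Cauchy-Schwarz, with \<open>k\<close> free to be tuned.\<close>

lemma card_collisions_ge:
  fixes f :: "'a \<Rightarrow> 'b"
  assumes "finite B" "finite L" "f ` B \<subseteq> L"
  shows "k * card B \<le> k ^ 2 * card L + card {(x, y) \<in> B \<times> B. x \<noteq> y \<and> f x = f y}"
proof -
  define D where "D l = {x \<in> B. f x = l}" for l
  define P where "P l = {(x, y) \<in> D l \<times> D l. x \<noteq> y}" for l
  have fin: "finite (D l)" "finite (P l)" for l
    using assms(1) by (auto simp: D_def P_def intro: finite_subset[of _ "B \<times> B"])
  have "B = (\<Union>l\<in>L. D l)"
    using assms(3) by (auto simp: D_def)
  then have cB: "card B = (\<Sum>l\<in>L. card (D l))"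
    using card_UN_disjoint[OF assms(2), of D] fin by (auto simp: D_def)
  have "{(x, y) \<in> B \<times> B. x \<noteq> y \<and> f x = f y} = (\<Union>l\<in>L. P l)"
    using assms(3) by (auto simp: P_def D_def)
  then have cP: "card {(x, y) \<in> B \<times> B. x \<noteq> y \<and> f x = f y} = (\<Sum>l\<in>L. card (P l))"
    using card_UN_disjoint[OF assms(2), of P] fin by (auto simp: P_def D_def)
  have "k * card (D l) \<le> k ^ 2 + card (P l)" for l
  proof -
    have D: "D l \<times> D l = P l \<union> (\<lambda>x. (x, x)) ` D l"
      by (auto simp: P_def)
    have "card (P l \<union> (\<lambda>x. (x, x)) ` D l) = card (P l) + card ((\<lambda>x. (x, x)) ` D l)"
      using fin by (intro card_Un_disjoint) (auto simp: P_def)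
    then have "card (D l) * card (D l) = card (P l) + card (D l)"
      by (simp add: card_image inj_on_def flip: D card_cartesian_product)
    moreover have "k * d \<le> k ^ 2 + p" if "d * d = p + d" for d p :: nat
    proof (cases "d \<le> k")
      case True
      then show ?thesis by (simp add: power2_eq_square trans_le_add1)
    next
      case False
      then have "(k + 1) * d \<le> d * d" by (intro mult_right_mono) auto
      then show ?thesis using that by simp
    qed
    ultimately show ?thesis by blast
  qed
  then have "(\<Sum>l\<in>L. k * card (D l)) \<le> (\<Sum>l\<in>L. k ^ 2 + card (P l))"
    by (intro sum_mono)
  then show ?thesis
    unfolding cB cP by (simp add: sum_distrib_left sum.distrib mult.commute)
qed

section \<open>The incidence graph of points and axis-parallel lines\<close>

definition grid :: "nat \<Rightarrow> nat \<Rightarrow> (nat \<Rightarrow> nat) set" where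
  "grid r n = {..<r} \<rightarrow>\<^sub>E {..<n}"

text \<open>The line through \<open>x\<close> in direction \<open>i\<close>, encoded by \<open>i\<close> and the other coordinates of \<open>x\<close>.\<close>

definition line :: "nat \<Rightarrow> (nat \<Rightarrow> nat) \<Rightarrow> nat \<times> (nat \<Rightarrow> nat)" where
  "line i x = (i, x(i := undefined))"

type_synonym vertex = "(nat \<Rightarrow> nat) + nat \<times> (nat \<Rightarrow> nat)"

definition incidence :: "(nat \<Rightarrow> nat) \<times> nat \<Rightarrow> vertex set" where
  "incidence = (\<lambda>(x, i). {Inl x, Inr (line i x)})"

definition grid_vertices :: "nat \<Rightarrow> nat \<Rightarrow> vertex set" where
  "grid_vertices r n = Inl ` grid r n \<union> Inr ` (\<lambda>(x, i). line i x) ` (grid r n \<times> {..<r})"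

definition grid_edges :: "nat \<Rightarrow> nat \<Rightarrow> vertex set set" where
  "grid_edges r n = incidence ` (grid r n \<times> {..<r})"

lemma finite_grid: "finite (grid r n)"
  by (simp add: grid_def finite_PiE)

lemma card_grid: "card (grid r n) = n ^ r"
  by (simp add: grid_def card_PiE)

text \<open>The \<open>Inl\<close> end of an edge is the point, and the code of the line at the
  other end starts with the direction. Sets of edges can therefore be counted as sets of pairs
  (point, direction).\<close>

lemma inj_incidence: "inj incidence"
  by (auto simp: inj_def incidence_def line_def doubleton_eq_iff)

lemma card_grid_edges: "card (grid_edges r n) = n ^ r * r"
  by (simp add: grid_edges_def card_image inj_on_subset[OF inj_incidence]
      card_cartesian_product card_grid)

lemma card_grid_vertices_ge: "n ^ r \<le> card (grid_vertices r n)"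
proof -
  have "card (grid r n) = card (Inl ` grid r n :: vertex set)"
    by (simp add: card_image)
  also have "\<dots> \<le> card (grid_vertices r n)"
    by (intro card_mono) (auto simp: grid_vertices_def finite_grid)
  finally show ?thesis
    by (simp add: card_grid)
qed

lemma simple_graph_grid: "simple_graph (grid_vertices r n) (grid_edges r n)"
  unfolding simple_graph_def
proof (intro conjI ballI)
  show "finite (grid_vertices r n)"
    by (simp add: grid_vertices_def finite_grid)
next
  fix e assume "e \<in> grid_edges r n"
  then obtain x i where "x \<in> grid r n" "i < r" "e = {Inl x, Inr (line i x)}"
    by (auto simp: grid_edges_def incidence_def)
  then show "\<exists>u v. e = {u, v} \<and> u \<noteq> v \<and> u \<in> grid_vertices r n \<and> v \<in> grid_vertices r n"
    by (intro exI[of _ "Inl x"] exI[of _ "Inr (line i x)"]) (auto simp: grid_vertices_def)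
qed

lemma bipartite_grid: "bipartite (grid_vertices r n) (grid_edges r n)"
  unfolding bipartite_def
  by (rule exI[of _ "Inl ` grid r n"])
    (auto simp: grid_vertices_def grid_edges_def incidence_def doubleton_eq_iff)

subsection \<open>Absence of 10-cycles\<close>

lemma no_closed_5_walk:
  fixes p0 p1 p2 p3 p4 :: "nat \<Rightarrow> nat"
  assumes on: "line d0 p0 = line d0 p1" "line d1 p1 = line d1 p2" "line d2 p2 = line d2 p3"
      "line d3 p3 = line d3 p4" "line d4 p4 = line d4 p0"
    and ne: "p0 \<noteq> p1" "p1 \<noteq> p2" "p2 \<noteq> p3" "p3 \<noteq> p4" "p4 \<noteq> p0"
    and turn: "d0 \<noteq> d1" "d1 \<noteq> d2" "d2 \<noteq> d3" "d3 \<noteq> d4" "d4 \<noteq> d0"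
  shows False
proof -
  have moves: "x d \<noteq> y d" if "line d x = line d y" "x \<noteq> y" for d x y
    using that unfolding line_def by (metis fun_upd_triv fun_upd_upd snd_conv)
  have stays: "x j = y j" if "line d x = line d y" "j \<noteq> d" for d j x y
    using that unfolding line_def by (metis fun_upd_other snd_conv)
  \<comment> \<open>The first step changes coordinate \<open>d0\<close>. As the walk closes up, some
    other step must change it too, and the two neighbouring steps have other directions. The next
    four claims are the rotations of this one.\<close>
  have "d0 = d2 \<or> d0 = d3"
    using moves[OF on(1) ne(1)] stays[OF on(2), of d0] stays[OF on(3), of d0]
      stays[OF on(4), of d0] stays[OF on(5), of d0] turn by metis
  moreover have "d1 = d3 \<or> d1 = d4"
    using moves[OF on(2) ne(2)] stays[OF on(1), of d1] stays[OF on(3), of d1]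
      stays[OF on(4), of d1] stays[OF on(5), of d1] turn by metis
  moreover have "d2 = d4 \<or> d2 = d0"
    using moves[OF on(3) ne(3)] stays[OF on(1), of d2] stays[OF on(2), of d2]
      stays[OF on(4), of d2] stays[OF on(5), of d2] turn by metis
  moreover have "d3 = d0 \<or> d3 = d1"
    using moves[OF on(4) ne(4)] stays[OF on(1), of d3] stays[OF on(2), of d3]
      stays[OF on(3), of d3] stays[OF on(5), of d3] turn by metis
  moreover have "d4 = d1 \<or> d4 = d2"
    using moves[OF on(5) ne(5)] stays[OF on(1), of d4] stays[OF on(2), of d4]
      stays[OF on(3), of d4] stays[OF on(4), of d4] turn by metis
  ultimately show False
    using turn by metis
qed

text \<open>Points and lines alternate along the cycle, so the even positions form a closed walk
  through five points and the odd positions are the lines joining consecutive ones.\<close>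

lemma no_10_cycle_from_point:
  fixes f :: "nat \<Rightarrow> vertex"
  assumes inj: "inj_on f {..<10}" and E: "\<And>i. i < 10 \<Longrightarrow> {f i, f ((i + 1) mod 10)} \<in> grid_edges r n"
    and "isl (f 0)"
  shows False
proof -
  have flip: "isl (f (Suc i)) \<longleftrightarrow> \<not> isl (f i)" if "Suc i < 10" for i
    using E[of i] that by (auto simp: grid_edges_def incidence_def doubleton_eq_iff)
  have isl: "isl (f i) \<longleftrightarrow> even i" if "i < 10" for i
    using that by (induction i) (use assms(3) flip in auto)
  obtain p0 p1 p2 p3 p4 where p: "f 0 = Inl p0" "f 2 = Inl p1" "f 4 = Inl p2" "f 6 = Inl p3"
    "f 8 = Inl p4"
    using isl[of 0] isl[of 2] isl[of 4] isl[of 6] isl[of 8] by (auto simp: isl_def)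
  have "\<exists>d q. f i = Inr (d, q)" if "odd i" "i < 10" for i
    using isl that by (metis sum.collapse(2) surj_pair)
  from this[of 1] this[of 3] this[of 5] this[of 7] this[of 9]
  obtain d0 d1 d2 d3 d4 q0 q1 q2 q3 q4 where l: "f 1 = Inr (d0, q0)" "f 3 = Inr (d1, q1)"
    "f 5 = Inr (d2, q2)" "f 7 = Inr (d3, q3)" "f 9 = Inr (d4, q4)"
    by auto
  have inc: "(d, q) = line d x" if "{Inl x, Inr (d, q)} \<in> grid_edges r n" for d q x
    using that by (auto simp: grid_edges_def incidence_def line_def doubleton_eq_iff)
  have inc': "(d, q) = line d x" if "{Inr (d, q), Inl x} \<in> grid_edges r n" for d q x
    using that inc by (simp add: insert_commute)
  have left: "(d0, q0) = line d0 p0" "(d1, q1) = line d1 p1" "(d2, q2) = line d2 p2"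
    "(d3, q3) = line d3 p3" "(d4, q4) = line d4 p4"
    using E[of 0] E[of 2] E[of 4] E[of 6] E[of 8] by (auto simp: p l l(1)[simplified] intro!: inc)
  have right: "(d0, q0) = line d0 p1" "(d1, q1) = line d1 p2" "(d2, q2) = line d2 p3"
    "(d3, q3) = line d3 p4" "(d4, q4) = line d4 p0"
    using E[of 1] E[of 3] E[of 5] E[of 7] E[of 9] by (auto simp: p p(2)[unfolded numeral_2_eq_2] l l(1)[simplified] intro!: inc')
  have ne: "f i \<noteq> f j" if "i < 10" "j < 10" "i \<noteq> j" for i j
    using inj that by (simp add: inj_on_eq_iff)
  show False
  proof (rule no_closed_5_walk)
    show "line d0 p0 = line d0 p1" "line d1 p1 = line d1 p2" "line d2 p2 = line d2 p3"
      "line d3 p3 = line d3 p4" "line d4 p4 = line d4 p0"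
      using left right by metis+
    show "p0 \<noteq> p1" "p1 \<noteq> p2" "p2 \<noteq> p3" "p3 \<noteq> p4" "p4 \<noteq> p0"
      using ne[of 0 2] ne[of 2 4] ne[of 4 6] ne[of 6 8] ne[of 8 0] p by auto
    \<comment> \<open>Consecutive lines share a point, so equal directions would make them the same
      vertex of the cycle.\<close>
    show "d0 \<noteq> d1" "d1 \<noteq> d2" "d2 \<noteq> d3" "d3 \<noteq> d4" "d4 \<noteq> d0"
      using ne[of 1 3, simplified, unfolded l[simplified]] ne[of 3 5, unfolded l]
        ne[of 5 7, unfolded l] ne[of 7 9, unfolded l] ne[of 9 1, simplified, unfolded l[simplified]]
        left right by auto
  qed
qed

lemma no_10_cycle: "\<not> has_cycle 10 (grid_edges r n)"
proof
  assume "has_cycle 10 (grid_edges r n)"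
  then obtain f :: "nat \<Rightarrow> vertex" where inj: "inj_on f {..<10}"
    and E: "\<And>i. i < 10 \<Longrightarrow> {f i, f ((i + 1) mod 10)} \<in> grid_edges r n"
    unfolding has_cycle_def by blast
  show False
  proof (cases "isl (f 0)")
    case True
    then show ?thesis using no_10_cycle_from_point[OF inj E] by blast
  next
    case False
    \<comment> \<open>A cycle starting at a line is rotated by one position to start at a
      point.\<close>
    define g where "g i = f ((i + 1) mod 10)" for i
    have shift: "inj_on (\<lambda>i::nat. (i + 1) mod 10) {..<10}"
      by (auto simp: inj_on_def mod_Suc split: if_splits)
    have "inj_on (f \<circ> (\<lambda>i. (i + 1) mod 10)) {..<10}"
      by (rule comp_inj_on[OF shift inj_on_subset[OF inj]]) auto
    then have "inj_on g {..<10}"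
      unfolding g_def comp_def .
    moreover have "{g i, g ((i + 1) mod 10)} \<in> grid_edges r n" for i
      unfolding g_def by (rule E) simp
    moreover have "isl (g 0)"
      using E[of 0] False by (auto simp: g_def grid_edges_def incidence_def doubleton_eq_iff)
    ultimately show ?thesis using no_10_cycle_from_point by blast
  qed
qed

subsection \<open>8-cycles in dense subgraphs\<close>

lemma all_less_8: "(\<forall>k<8::nat. P k) \<longleftrightarrow> P 0 \<and> P 1 \<and> P 2 \<and> P 3 \<and> P 4 \<and> P 5 \<and> P 6 \<and> P 7"
proof -
  have "(\<forall>k<8::nat. P k) \<longleftrightarrow> (\<forall>k\<in>set [0..<8]. P k)"
    by auto
  also have "[0..<8] = [0, 1, 2, 3, 4, 5, 6, 7]"
    by (simp add: upt_rec)
  finally show ?thesis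
    by simp
qed

text \<open>The perimeter visits the corners in the order \<open>x\<close>, \<open>y\<close>,
  \<open>w\<close>, \<open>z\<close>, with \<open>w\<close> opposite to \<open>x\<close>.
  Coordinates \<open>i\<close> and \<open>j\<close> alone tell the four corners apart, so nothing
  needs to be assumed about \<open>w\<close> being distinct from the others.\<close>

lemma has_8_cycle_rectangle:
  assumes "i \<noteq> j" "x \<noteq> y" "x \<noteq> z"
    and sides: "line i x = line i y" "line j x = line j z" "line i z = line i w" "line j y = line j w"
    and F: "\<And>v. v \<in> {x, y, z, w} \<Longrightarrow> incidence (v, i) \<in> F \<and> incidence (v, j) \<in> F"
  shows "has_cycle 8 F"
proof -
  have moves: "u d \<noteq> v d" if "line d u = line d v" "u \<noteq> v" for d u v
    using that unfolding line_def by (metis fun_upd_triv fun_upd_upd snd_conv)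
  have stays: "u k = v k" if "line d u = line d v" "k \<noteq> d" for d k u v
    using that unfolding line_def by (metis fun_upd_other snd_conv)
  have i: "x i \<noteq> y i" "z i = x i" "w i = y i"
    using moves[OF sides(1) assms(2)] stays[OF sides(2) assms(1)] stays[OF sides(4) assms(1)] by auto
  have j: "x j \<noteq> z j" "y j = x j" "w j = z j"
    using moves[OF sides(2) assms(3)] stays[OF sides(1)] stays[OF sides(3)] assms(1) by auto
  \<comment> \<open>Opposite sides are parallel and differ in the coordinate that is constant along
    them; adjacent sides already differ in direction.\<close>
  have "line i x \<noteq> line i w" "line j y \<noteq> line j z"
    using stays[of i x w j] stays[of j y z i] i j assms(1) by auto
  moreover have "x \<noteq> w" "y \<noteq> z" "y \<noteq> w" "z \<noteq> w"
    using i j by auto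
  moreover have "line i u \<noteq> line j v" "line j v \<noteq> line i u" for u v
    using assms(1) by (simp_all add: line_def)
  ultimately have dist: "distinct [Inl x, Inr (line i x), Inl y, Inr (line j y),
      Inl w, Inr (line i w), Inl z, Inr (line j z)]" (is "distinct ?c")
    using assms(2,3) by auto
  have mem: "{Inl v, Inr (line d v)} \<in> F" "{Inr (line d v), Inl v} \<in> F"
    if "v \<in> {x, y, z, w}" "d \<in> {i, j}" for v d
    using F[OF that(1)] that(2) by (auto simp: incidence_def insert_commute)
  have "\<forall>k<8. {?c ! k, ?c ! ((k + 1) mod 8)} \<in> F"
    unfolding all_less_8
    using mem[of x i] mem[of y i] mem[of y j] mem[of w j] mem[of w i] mem[of z i] mem[of z j]
      mem[of x j] sides
    by simp
  moreover have "inj_on ((!) ?c) {..<8}"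
    by (rule inj_on_nth[OF dist]) simp
  ultimately show ?thesis
    unfolding has_cycle_def by (intro conjI exI[of _ "(!) ?c"]) auto
qed

text \<open>Ordered pairs of distinct points of \<open>B\<close> on a common line in direction
  \<open>i\<close> are bounded above by \<open>n ^ r\<close>, since rectangle-freeness makes an
  encoding of them injective, and below by \<open>card_collisions_ge\<close> over the
  \<open>n ^ (r - 1)\<close> lines of that direction.\<close>

lemma card_rectangle_free_le:
  assumes B: "B \<subseteq> grid r n" and ij: "i \<noteq> j" "i < r" "j < r"
    and free: "\<And>x y z w. {x, y, z, w} \<subseteq> B \<Longrightarrow> x \<noteq> y \<Longrightarrow> x \<noteq> z \<Longrightarrow> line i x = line i y \<Longrightarrow>
      line j x = line j z \<Longrightarrow> line i z = line i w \<Longrightarrow> line j y = line j w \<Longrightarrow> False"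
  shows "k * card B \<le> k ^ 2 * n ^ (r - 1) + n ^ r"
proof -
  have fold_line: "line d x = line d y \<longleftrightarrow> x(d := undefined) = y(d := undefined)" for d x y
    by (simp add: line_def)
  \<comment> \<open>Erasing coordinate \<open>d\<close> of a grid point with
    \<open>undefined\<close> leaves exactly an extensional function on the other coordinates, so
    \<open>S d\<close> parametrizes the lines in direction \<open>d\<close>.\<close>
  define S where "S d = ({..<r} - {d}) \<rightarrow>\<^sub>E {..<n}" for d
  have S: "x(d := undefined) \<in> S d" if "x \<in> grid r n" "d < r" for x d
    using that by (auto simp: S_def grid_def PiE_iff extensional_def)
  have cS: "finite (S d)" "card (S d) = n ^ (r - 1)" if "d < r" for d
    using that by (simp_all add: S_def finite_PiE card_PiE)
  define P where "P = {(x, y) \<in> B \<times> B. x \<noteq> y \<and> x(i := undefined) = y(i := undefined)}"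
  \<comment> \<open>A pair is encoded by the line through \<open>x\<close> in direction
    \<open>j\<close> and the \<open>i\<close>-coordinate of \<open>y\<close>. Together these fix the
    line through \<open>y\<close> in direction \<open>j\<close>, so two pairs with the same code and
    different first points span a rectangle.\<close>
  define g where "g = (\<lambda>(x::nat \<Rightarrow> nat, y::nat \<Rightarrow> nat). (x(j := undefined), y i))"
  have "inj_on g P"
  proof (rule inj_onI, clarify)
    fix x y z w
    assume xy: "(x, y) \<in> P" and zw: "(z, w) \<in> P" and eq: "g (x, y) = g (z, w)"
    have xz: "x(j := undefined) = z(j := undefined)" and yw: "y i = w i"
      using eq by (auto simp: g_def)
    have yi: "y = x(i := y i)" and wi: "w = z(i := w i)"
      using xy zw by (auto simp: P_def) (metis fun_upd_triv fun_upd_upd)+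
    have "x = z"
    proof (rule ccontr)
      assume "x \<noteq> z"
      moreover have "y(j := undefined) = w(j := undefined)"
        using yi wi xz yw ij(1) by (metis fun_upd_twist)
      ultimately show False
        using free[of x y z w] xy zw xz by (auto simp: P_def fold_line)
    qed
    then show "x = z \<and> y = w"
      using yi wi yw by metis
  qed
  moreover have "g ` P \<subseteq> S j \<times> {..<n}"
    using B S[OF _ ij(3)] ij(2) by (auto simp: g_def P_def grid_def)
  ultimately have "card P \<le> card (S j \<times> {..<n})"
    using cS ij(3) by (intro card_inj_on_le) auto
  also have "\<dots> = n ^ r"
    using cS ij(3) by (simp add: card_cartesian_product power_eq_if)
  finally have "card P \<le> n ^ r" .
  moreover have "k * card B \<le> k ^ 2 * card (S i) + card P"
    unfolding P_def using B S cS ij(2)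
    by (intro card_collisions_ge) (auto intro: finite_subset[OF _ finite_grid])
  ultimately show ?thesis
    using cS ij(2) by simp
qed

text \<open>Having \<open>2 * n ^ r\<close> incidences on \<open>n ^ r\<close> points forces at
  least \<open>n ^ r\<close> ordered pairs of distinct incidences at a common point. They are spread
  over at most \<open>r ^ 2\<close> ordered pairs of directions, whereas without a rectangle each of
  these accounts for too few.\<close>

lemma has_8_cycle_dense:
  assumes r: "r > 0" and n: "n \<ge> (2 * r ^ 2 + 1) ^ 2"
    and F: "F \<subseteq> grid_edges r n" "card F \<ge> 2 * n ^ r"
  shows "has_cycle 8 F"
proof (rule ccontr)
  assume no: "\<not> has_cycle 8 F"
  \<comment> \<open>Any \<open>k\<close> above \<open>2 * r ^ 2\<close> contradicts the final
    inequality \<open>k \<le> r ^ 2 * 2\<close>.\<close>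
  define k where "k = 2 * r ^ 2 + 1"
  define S where "S = {s \<in> grid r n \<times> {..<r}. incidence s \<in> F}"
  define B where "B i j = {x \<in> grid r n. incidence (x, i) \<in> F \<and> incidence (x, j) \<in> F}" for i j
  have finB: "finite (B i j)" for i j
    by (simp add: B_def finite_grid)
  have "n > 0"
    using n by (metis add_is_0 gr0I le_zero_eq one_neq_zero power_not_zero)
  have "F = incidence ` S"
    using F(1) by (auto simp: S_def grid_edges_def)
  then have cF: "card F = card S"
    by (simp add: card_image inj_on_subset[OF inj_incidence])
  have B_le: "k * card (B i j) \<le> 2 * n ^ r" if ij: "i \<noteq> j" "i < r" "j < r" for i j
  proof -
    have "k * card (B i j) \<le> k ^ 2 * n ^ (r - 1) + n ^ r"
    proof (rule card_rectangle_free_le[OF _ ij])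
      show "B i j \<subseteq> grid r n"
        by (auto simp: B_def)
    next
      fix x y z w
      assume *: "{x, y, z, w} \<subseteq> B i j" "x \<noteq> y" "x \<noteq> z" "line i x = line i y"
        "line j x = line j z" "line i z = line i w" "line j y = line j w"
      have "has_cycle 8 F"
        by (rule has_8_cycle_rectangle[OF ij(1) *(2-7)]) (use *(1) in \<open>auto simp: B_def\<close>)
      then show False using no by blast
    qed
    \<comment> \<open>This is where the size of \<open>n\<close> enters:
      \<open>k ^ 2 \<le> n\<close>.\<close>
    also have "k ^ 2 * n ^ (r - 1) \<le> n * n ^ (r - 1)"
      using n by (intro mult_right_mono) (auto simp: k_def)
    also have "n * n ^ (r - 1) = n ^ r"
      using r by (simp add: power_eq_if)
    finally show ?thesis by simp
  qed
  define Q where "Q = {(s, t) \<in> S \<times> S. s \<noteq> t \<and> fst s = fst t}"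
  define I where "I = {(i, j) \<in> {..<r} \<times> {..<r}. i \<noteq> j}"
  have "finite I"
    by (auto simp: I_def intro: finite_subset[of _ "{..<r} \<times> {..<r}"])
  have "card I \<le> card ({..<r} \<times> {..<r})"
    by (intro card_mono) (auto simp: I_def)
  then have cI: "card I \<le> r ^ 2"
    by (simp add: card_cartesian_product power2_eq_square)
  have "finite S"
    by (auto simp: S_def finite_grid intro: finite_subset[of _ "grid r n \<times> {..<r}"])
  \<comment> \<open>Collisions of the projection to the point, with parameter 1.\<close>
  then have "1 * card S \<le> 1 ^ 2 * card (grid r n) + card Q"
    unfolding Q_def by (intro card_collisions_ge) (auto simp: finite_grid S_def)
  then have "n ^ r \<le> card Q"
    using F(2) cF by (simp add: card_grid)
  \<comment> \<open>Distinct incidences at one point have different directions, and a pair of them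
    is determined by the two directions and the point.\<close>
  also have "card Q \<le> card (SIGMA (i, j):I. B i j)"
  proof (rule card_inj_on_le)
    let ?h = "\<lambda>(s, t). ((snd s, snd t), fst s)"
    show "inj_on ?h Q"
      by (auto simp: inj_on_def Q_def)
    show "?h ` Q \<subseteq> (SIGMA (i, j):I. B i j)"
      by (auto simp: Q_def S_def I_def B_def)
    show "finite (SIGMA (i, j):I. B i j)"
      using \<open>finite I\<close> finB by auto
  qed
  also have "\<dots> = (\<Sum>(i, j)\<in>I. card (B i j))"
    using \<open>finite I\<close> finB by (subst card_SigmaI) (auto simp: case_prod_unfold)
  finally have "k * n ^ r \<le> (\<Sum>(i, j)\<in>I. k * card (B i j))"
    by (simp add: sum_distrib_left[symmetric] case_prod_unfold)
  also have "\<dots> \<le> (\<Sum>(i, j)\<in>I. 2 * n ^ r)"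
    using B_le by (intro sum_mono) (auto simp: I_def)
  also have "\<dots> = card I * (2 * n ^ r)"
    by (simp add: case_prod_unfold)
  also have "\<dots> \<le> r ^ 2 * (2 * n ^ r)"
    using cI by (intro mult_right_mono) auto
  finally have "k \<le> r ^ 2 * 2"
    using \<open>n > 0\<close> by (simp flip: mult.assoc)
  then show False
    by (simp add: k_def)
qed

section \<open>Choice of the dimension and side length of the grid\<close>

theorem theorem1p2:
  fixes c :: real and N0 :: nat
  assumes "c > 0" and "N0 > 0"
  shows "\<exists>(N::nat) (E::nat set set). N \<ge> N0 \<and> simple_graph {..<N} E \<and>
           bipartite {..<N} E \<and> \<not> has_cycle 10 E \<and>
           (\<forall>F \<subseteq> E. real (card F) \<ge> c * real (card E) \<longrightarrow> has_cycle 8 F)"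
proof -
  obtain r :: nat where r: "2 / c < real r"
    using reals_Archimedean2 by blast
  then have "real r > 0"
    using assms(1) by (meson divide_pos_pos less_trans zero_less_numeral)
  then have "r > 0" by simp
  have cr: "2 \<le> c * real r"
    using r assms(1) by (simp add: field_simps)
  \<comment> \<open>The first term makes the points alone number at least \<open>N0\<close>; the
    second is the threshold of \<open>has_8_cycle_dense\<close>.\<close>
  define n where "n = max N0 ((2 * r ^ 2 + 1) ^ 2)"
  have "has_cycle 8 F"
    if F: "F \<subseteq> grid_edges r n" "real (card F) \<ge> c * real (card (grid_edges r n))" for F
  proof (rule has_8_cycle_dense[OF \<open>r > 0\<close> _ F(1)])
    show "(2 * r ^ 2 + 1) ^ 2 \<le> n"
      by (simp add: n_def)
    \<comment> \<open>The grid graph has \<open>n ^ r * r\<close> edges, so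
      \<open>2 \<le> c * r\<close> turns the fraction \<open>c\<close> of them into two incidences
      per point on average.\<close>
    have "2 * real (n ^ r) \<le> c * real r * real (n ^ r)"
      using cr by (intro mult_right_mono) auto
    also have "\<dots> \<le> real (card F)"
      using F(2) by (simp add: card_grid_edges mult_ac)
    finally show "2 * n ^ r \<le> card F"
      by linarith
  qed
  from transport_to_nat[OF simple_graph_grid bipartite_grid no_10_cycle this]
  obtain E :: "nat set set" where "simple_graph {..<card (grid_vertices r n)} E"
    "bipartite {..<card (grid_vertices r n)} E" "\<not> has_cycle 10 E"
    "\<forall>F \<subseteq> E. real (card F) \<ge> c * real (card E) \<longrightarrow> has_cycle 8 F"
    by blast
  moreover have "N0 \<le> card (grid_vertices r n)"
  proof -
    have "N0 \<le> n" by (simp add: n_def)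
    also have "n \<le> n ^ r"
      using \<open>r > 0\<close> \<open>N0 \<le> n\<close> assms(2) by (intro self_le_power) auto
    also have "\<dots> \<le> card (grid_vertices r n)"
      by (rule card_grid_vertices_ge)
    finally show ?thesis .
  qed
  ultimately show ?thesis by blast
qed

end
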